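(* Let $\mathcal{M}=(U,\mathcal{L})$ be a finitary complex of oriented matroids. Then the cell complex $\Delta(\mathcal{L})$ is contractible.
   Context: Sign vectors on a countable set $U$ are maps $U\to\{-1,0,+1\}$. For $X,Y$: $X^0=\{e:X_e=0\}$, $X^+=\{e:X_e=+1\}$, $\mathrm{Sep}(X,Y)=\{e:X_eY_e=-1\}$, $(X\circ Y)_e=X_e$ if $X_e\ne0$ else $Y_e$. Order $\le$: product order with $0\le -1$, $0\le +1$. A finitary COM is a simple set $\mathcal{L}$ of sign vectors ($\{X_e:X\in\mathcal{L}\}=\{-1,0,+1\}$ for all $e$) on countable $U$ satisfying (SE) for $X,Y\in\mathcal{L}$ and $e\in\mathrm{Sep}(X,Y)$ there is $Z\in\mathcal{L}$ with $Z_e=0$ and $Z_f=(X\circ Y)_f$ for $f\notin\mathrm{Sep}(X,Y)$; (FS) $X\circ(-Y)\in\mathcal{L}$; (S) $|\mathrm{Sep}(X,Y)|<\infty$; (PZ) $|X^+|,|X^0|<\infty$; (I) each $X\in\mathcal{L}$ has only finitely many elements of $\mathcal{L}$ below it. For $X\in\mathcal{L}$ the face $\mathrm{Face}(X)=\{Y\in\mathcal{L}:X\le Y\}$ is a (finite) oriented matroid, and $\Delta(\mathcal{L})$ is the regular cell complex obtained by replacing each face $\mathrm{Face}(X)$ by a PL-ball, the cell of $Y$ being a face of the cell of $X$ iff $X\le Y$. *)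

theory Defs
  imports "HOL-Analysis.Analysis"
begin

section \<open>Sign vectors\<close>

text \<open>Sign vectors on \<open>U\<close> are extensional functions, so that equality of sign vectors is
  equality of their restrictions to \<open>U\<close>.\<close>

definition sign_vectors :: "'u set \<Rightarrow> ('u \<Rightarrow> int) set" where
  "sign_vectors U = (U \<rightarrow>\<^sub>E {-1, 0, 1})"

definition zero_set :: "'u set \<Rightarrow> ('u \<Rightarrow> int) \<Rightarrow> 'u set" where
  "zero_set U X = {e \<in> U. X e = 0}"

definition pos_set :: "'u set \<Rightarrow> ('u \<Rightarrow> int) \<Rightarrow> 'u set" where
  "pos_set U X = {e \<in> U. X e = 1}"

definition Sep :: "'u set \<Rightarrow> ('u \<Rightarrow> int) \<Rightarrow> ('u \<Rightarrow> int) \<Rightarrow> 'u set" where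
  "Sep U X Y = {e \<in> U. X e * Y e = -1}"

definition sv_comp :: "'u set \<Rightarrow> ('u \<Rightarrow> int) \<Rightarrow> ('u \<Rightarrow> int) \<Rightarrow> 'u \<Rightarrow> int" where
  "sv_comp U X Y = (\<lambda>e\<in>U. if X e \<noteq> 0 then X e else Y e)"

definition sv_neg :: "'u set \<Rightarrow> ('u \<Rightarrow> int) \<Rightarrow> 'u \<Rightarrow> int" where
  "sv_neg U X = (\<lambda>e\<in>U. - X e)"

text \<open>The product of the order on signs in which \<open>0\<close> lies below the incomparable elements
  \<open>-1\<close> and \<open>1\<close>; this is not the order induced by \<^typ>\<open>int\<close>.\<close>

definition sign_le :: "int \<Rightarrow> int \<Rightarrow> bool" where
  "sign_le s t \<longleftrightarrow> s = t \<or> (s = 0 \<and> t \<in> {-1, 1})"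

definition sv_le :: "'u set \<Rightarrow> ('u \<Rightarrow> int) \<Rightarrow> ('u \<Rightarrow> int) \<Rightarrow> bool" where
  "sv_le U X Y \<longleftrightarrow> (\<forall>e\<in>U. sign_le (X e) (Y e))"


section \<open>Finitary complexes of oriented matroids\<close>

locale finitary_COM =
  fixes U :: "'u set" and L :: "('u \<Rightarrow> int) set"
  assumes countable_ground: "countable U"
    and sign_vectors: "L \<subseteq> sign_vectors U"
    and simple: "\<And>e. e \<in> U \<Longrightarrow> (\<lambda>X. X e) ` L = {-1, 0, 1}"
    and SE: "\<And>X Y e. \<lbrakk>X \<in> L; Y \<in> L; e \<in> Sep U X Y\<rbrakk> \<Longrightarrow>
        \<exists>Z\<in>L. Z e = 0 \<and> (\<forall>f\<in>U - Sep U X Y. Z f = sv_comp U X Y f)"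
    and FS: "\<And>X Y. \<lbrakk>X \<in> L; Y \<in> L\<rbrakk> \<Longrightarrow> sv_comp U X (sv_neg U Y) \<in> L"
    and S: "\<And>X Y. \<lbrakk>X \<in> L; Y \<in> L\<rbrakk> \<Longrightarrow> finite (Sep U X Y)"
    and PZ: "\<And>X. X \<in> L \<Longrightarrow> finite (pos_set U X) \<and> finite (zero_set U X)"
    and I: "\<And>X. X \<in> L \<Longrightarrow> finite {Y \<in> L. sv_le U Y X}"

definition Face :: "'u set \<Rightarrow> ('u \<Rightarrow> int) set \<Rightarrow> ('u \<Rightarrow> int) \<Rightarrow> ('u \<Rightarrow> int) set" where
  "Face U L X = {Y \<in> L. sv_le U X Y}"


section \<open>Regular cell complexes\<close>

text \<open>Balls live in \<^const>\<open>Euclidean_space\<close> so that the dimension can vary from cell to cell.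
  In dimension \<open>0\<close> the ball and the open ball are a single point, and the sphere is empty.\<close>

definition unit_ball :: "nat \<Rightarrow> (nat \<Rightarrow> real) set" where
  "unit_ball n = {x \<in> topspace (Euclidean_space n). (\<Sum>i<n. (x i)\<^sup>2) \<le> 1}"

definition open_unit_ball :: "nat \<Rightarrow> (nat \<Rightarrow> real) set" where
  "open_unit_ball n = {x \<in> topspace (Euclidean_space n). (\<Sum>i<n. (x i)\<^sup>2) < 1}"

definition unit_sphere :: "nat \<Rightarrow> (nat \<Rightarrow> real) set" where
  "unit_sphere n = {x \<in> topspace (Euclidean_space n). (\<Sum>i<n. (x i)\<^sup>2) = 1}"

text \<open>A regular CW complex with underlying space \<open>T\<close> and cells indexed by \<open>J\<close>: the closed cell
  of \<open>j\<close> is a ball of dimension \<open>d j\<close>, parametrised by the homeomorphism \<open>\<phi> j\<close>.\<close>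

locale regular_cell_complex =
  fixes T :: "'p topology" and J :: "'j set"
    and d :: "'j \<Rightarrow> nat" and \<phi> :: "'j \<Rightarrow> (nat \<Rightarrow> real) \<Rightarrow> 'p"
  assumes Hausdorff: "Hausdorff_space T"
    and cell_subset: "\<And>j. j \<in> J \<Longrightarrow> \<phi> j ` unit_ball (d j) \<subseteq> topspace T"
    and cell_ball: "\<And>j. j \<in> J \<Longrightarrow>
        homeomorphic_map (subtopology (Euclidean_space (d j)) (unit_ball (d j)))
          (subtopology T (\<phi> j ` unit_ball (d j))) (\<phi> j)"
    and open_cells_disjoint: "disjoint_family_on (\<lambda>j. \<phi> j ` open_unit_ball (d j)) J"
    and open_cells_cover: "(\<Union>j\<in>J. \<phi> j ` open_unit_ball (d j)) = topspace T"
    and boundary: "\<And>j. j \<in> J \<Longrightarrow> \<exists>K\<subseteq>J. finite K \<and> (\<forall>k\<in>K. d k < d j) \<and>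
        \<phi> j ` unit_sphere (d j) = (\<Union>k\<in>K. \<phi> k ` unit_ball (d k))"
    and weak_topology: "\<And>A. \<lbrakk>A \<subseteq> topspace T;
        \<And>j. j \<in> J \<Longrightarrow> closedin (subtopology T (\<phi> j ` unit_ball (d j))) (A \<inter> \<phi> j ` unit_ball (d j))\<rbrakk>
        \<Longrightarrow> closedin T A"

text \<open>\<open>\<Delta>(L)\<close> is determined only up to (cell-preserving) homeomorphism. The following says that
  \<open>T\<close> with the cells \<open>\<phi>\<close> is a copy of it: each \<^term>\<open>Face U L X\<close> is replaced by one ball, and
  inclusion of closed cells is inclusion of faces. There is no separate condition that the balls be
  piecewise linear: the face poset of a regular cell complex determines it up to homeomorphism.\<close>

locale COM_cell_complex =
  regular_cell_complex T L d \<phi>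
  for U :: "'u set" and L :: "('u \<Rightarrow> int) set" and T :: "'p topology"
    and d :: "('u \<Rightarrow> int) \<Rightarrow> nat" and \<phi> :: "('u \<Rightarrow> int) \<Rightarrow> (nat \<Rightarrow> real) \<Rightarrow> 'p" +
  assumes face_iff: "\<And>X Y. \<lbrakk>X \<in> L; Y \<in> L\<rbrakk> \<Longrightarrow>
      \<phi> Y ` unit_ball (d Y) \<subseteq> \<phi> X ` unit_ball (d X) \<longleftrightarrow> Y \<in> Face U L X"

end

theory Submission
  imports Defs
begin

text \<open>Up-closed subsets \<open>K\<close> of \<open>L\<close> correspond to subcomplexes, and intersections of up-closed sets
  to intersections of subcomplexes. The subcomplex of a finite nonempty COM \<open>K\<close> is an absolute
  extensor for hereditarily normal spaces, by induction on \<open>card K\<close>. Let \<open>X \<in> K\<close> have as many zeros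
  as possible. If \<open>X\<close> is the minimum of \<open>K\<close>, the complex is a ball and Tietze's theorem applies.
  Otherwise some element \<open>e\<close> with \<open>X e \<noteq> 0\<close> is not constant on \<open>K\<close>. Then \<open>K\<close> is the union of the
  carrier \<open>N\<close> of the hyperplane of \<open>e\<close>, which omits \<open>X\<close>, and the two open halfspaces of \<open>e\<close>, which
  meet \<open>N\<close> in the half-carriers. All of these are smaller COMs, and extensors can be glued along
  extensors.

  The sets of those \<open>X \<in> L\<close> that are negative outside the first \<open>n\<close> elements of \<open>U\<close> are finite COMs
  and exhaust \<open>L\<close> by (PZ). The extensor property extends a contraction of one stage to the next.
  By (I) the interiors of the stages cover the complex, so the union of these contractions is
  continuous.\<close>

section \<open>Absolute extensors\<close>

text \<open>The domain \<open>D\<close> is a parameter because a definition in HOL cannot quantify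
  over spaces of all types. With \<open>C\<close> empty the condition asks for some map from
  \<open>D\<close> into \<open>Y\<close>, whence the nonemptiness assumptions below.\<close>

definition extensor :: "'x topology \<Rightarrow> 'p topology \<Rightarrow> bool" where
  "extensor D Y \<longleftrightarrow> (\<forall>C f. closedin D C \<and> continuous_map (subtopology D C) Y f \<longrightarrow>
     (\<exists>g. continuous_map D Y g \<and> (\<forall>x\<in>C. g x = f x)))"

lemma extensorE:
  assumes "extensor D Y" "closedin D C" "continuous_map (subtopology D C) Y f"
  obtains g where "continuous_map D Y g" "\<And>x. x \<in> C \<Longrightarrow> g x = f x"
  using assms unfolding extensor_def by blast

lemma extensor_homeomorphic_map:
  assumes "homeomorphic_map X Y h" "extensor D X"
  shows "extensor D Y"
  unfolding extensor_def
proof (intro allI impI, elim conjE)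
  fix C f assume C: "closedin D C" and f: "continuous_map (subtopology D C) Y f"
  obtain k where hk: "homeomorphic_maps X Y h k"
    using assms(1) homeomorphic_map_maps by blast
  then have h: "continuous_map X Y h" and k: "continuous_map Y X k"
    and inv: "\<And>y. y \<in> topspace Y \<Longrightarrow> h (k y) = y"
    by (auto simp: homeomorphic_maps_def)
  obtain g where g: "continuous_map D X g" "\<And>x. x \<in> C \<Longrightarrow> g x = (k \<circ> f) x"
    using extensorE[OF assms(2) C continuous_map_compose[OF f k]] by blast
  have "f x \<in> topspace Y" if "x \<in> C" for x
    using that f C closedin_subset by (fastforce simp: continuous_map_def)
  then show "\<exists>g. continuous_map D Y g \<and> (\<forall>x\<in>C. g x = f x)"
    using continuous_map_compose[OF g(1) h] g(2) inv by (intro exI[of _ "h \<circ> g"]) auto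
qed

text \<open>Tietze's theorem extends each coordinate separately, and a radial retraction brings the
  result back into the ball.\<close>

lemma extensor_unit_ball:
  assumes "normal_space D"
  shows "extensor D (subtopology (Euclidean_space n) (unit_ball n))"
  unfolding extensor_def
proof (intro allI impI, elim conjE)
  fix C f assume C: "closedin D C"
    and f: "continuous_map (subtopology D C) (subtopology (Euclidean_space n) (unit_ball n)) f"
  have comp: "continuous_map (subtopology D C) euclideanreal (\<lambda>x. f x i)" for i
    using f unfolding Euclidean_space_def continuous_map_in_subtopology
      continuous_map_componentwise_UNIV by blast
  have "\<exists>g. continuous_map D euclideanreal g \<and> (\<forall>x\<in>C. g x = f x i)" for i
    by (rule Tietze_extension_realinterval[OF assms C is_interval_univ UNIV_not_empty
          comp[of i] subset_UNIV]) blast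
  then obtain g where g: "\<And>i. continuous_map D euclideanreal (g i)"
    and gf: "\<And>i x. x \<in> C \<Longrightarrow> g i x = f x i"
    by metis
  \<comment> \<open>The larger of 1 and the norm: division by it moves points outside the ball onto
    the sphere and fixes the points of the ball.\<close>
  define m where "m x = max 1 (sqrt (\<Sum>k<n. (g k x)\<^sup>2))" for x
  have m1: "m x \<ge> 1" for x by (simp add: m_def)
  have ball: "f x \<in> unit_ball n" if "x \<in> C" for x
    using that f C closedin_subset by (fastforce simp: continuous_map_def)
  have cm: "continuous_map D euclideanreal m"
    unfolding m_def
    by (intro continuous_map_real_max continuous_map_sqrt continuous_map_sum continuous_map_real_pow g)
       auto
  have cont: "continuous_map D (Euclidean_space n) (\<lambda>x i. if i < n then g i x / m x else 0)"
    unfolding continuous_map_componentwise_Euclidean_space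
    using m1 by (intro allI impI continuous_map_real_divide g cm) (metis not_one_le_zero)
  have "(\<Sum>i<n. (g i x / m x)\<^sup>2) \<le> 1" for x
  proof -
    have "(\<Sum>i<n. (g i x / m x)\<^sup>2) = (\<Sum>i<n. (g i x)\<^sup>2) / (m x)\<^sup>2"
      by (simp add: power_divide sum_divide_distrib)
    moreover have "(\<Sum>i<n. (g i x)\<^sup>2) \<le> (m x)\<^sup>2"
      using sqrt_le_D[of "\<Sum>i<n. (g i x)\<^sup>2" "m x"] by (simp add: m_def)
    ultimately show ?thesis using m1[of x] by (simp add: divide_le_eq)
  qed
  then have "continuous_map D (subtopology (Euclidean_space n) (unit_ball n))
      (\<lambda>x i. if i < n then g i x / m x else 0)"
    using cont by (simp add: continuous_map_in_subtopology unit_ball_def topspace_Euclidean_space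
        image_subset_iff)
  moreover have "(\<lambda>i. if i < n then g i x / m x else 0) = f x" if x: "x \<in> C" for x
  proof -
    have "m x = 1"
      using ball[OF x] gf[OF x] by (simp add: m_def unit_ball_def)
    then show ?thesis
      using ball[OF x] gf[OF x] by (auto simp: unit_ball_def topspace_Euclidean_space)
  qed
  ultimately show "\<exists>g. continuous_map D (subtopology (Euclidean_space n) (unit_ball n)) g \<and>
      (\<forall>x\<in>C. g x = f x)"
    by blast
qed

lemma continuous_map_glue_closed:
  assumes "closedin D P" "closedin D Q"
    and "continuous_map (subtopology D P) Y f" "continuous_map (subtopology D Q) Y g"
    and agree: "\<And>x. x \<in> P \<Longrightarrow> x \<in> Q \<Longrightarrow> f x = g x"
  obtains h where "continuous_map (subtopology D (P \<union> Q)) Y h"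
    "\<And>x. x \<in> P \<Longrightarrow> h x = f x" "\<And>x. x \<in> Q \<Longrightarrow> h x = g x"
proof
  let ?h = "\<lambda>x. if x \<in> P then f x else g x"
  have PQ: "P \<subseteq> topspace D" "Q \<subseteq> topspace D" using assms closedin_subset by auto
  have sub: "subtopology (subtopology D (P \<union> Q)) P = subtopology D P"
    "subtopology (subtopology D (P \<union> Q)) Q = subtopology D Q"
    by (auto simp: subtopology_subtopology intro!: arg_cong[where f="subtopology D"])
  show "continuous_map (subtopology D (P \<union> Q)) Y ?h"
  proof (rule pasting_lemma_closed[where I="{True,False}" and T="\<lambda>b. if b then P else Q"
        and f="\<lambda>b. if b then f else g"])
    show "closedin (subtopology D (P \<union> Q)) (if b then P else Q)" for b
      using assms(1,2) by (auto intro: closedin_subset_topspace)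
  qed (use assms sub PQ in \<open>auto split: if_splits\<close>)
  show "x \<in> P \<Longrightarrow> ?h x = f x" "x \<in> Q \<Longrightarrow> ?h x = g x" for x using agree by auto
qed

text \<open>The differences \<open>P - Q\<close> and \<open>Q - P\<close> need not be closed, but
  neither meets the closure of the other. Hereditary normality puts such sets into disjoint open
  sets; the complements of these, with \<open>P\<close> and \<open>Q\<close> restored, are the
  closed sets sought.\<close>

lemma hereditarily_normal_closed_split:
  assumes "hereditarily normal_space D" "closedin D P" "closedin D Q"
  obtains P' Q' where "closedin D P'" "closedin D Q'" "P' \<union> Q' = topspace D"
    "P' \<inter> (P \<union> Q) = P" "Q' \<inter> (P \<union> Q) = Q"
proof -
  have sub: "P \<subseteq> topspace D" "Q \<subseteq> topspace D" using assms closedin_subset by auto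
  have "D closure_of (P - Q) \<subseteq> P" "D closure_of (Q - P) \<subseteq> Q"
    by (rule closure_of_minimal[OF Diff_subset assms(2)], rule closure_of_minimal[OF Diff_subset assms(3)])
  then have "separatedin D (P - Q) (Q - P)"
    using sub by (auto simp: separatedin_def)
  then obtain V W where VW: "openin D V" "openin D W" "P - Q \<subseteq> V" "Q - P \<subseteq> W" "disjnt V W"
    using assms(1) unfolding hereditarily_normal_separation by meson
  show thesis
  proof
    show "closedin D (topspace D - (W - P))" "closedin D (topspace D - (V - Q))"
      using VW assms(2,3) by (auto intro!: closedin_diff openin_diff)
  qed (use VW sub in \<open>auto simp: disjnt_def\<close>)
qed

text \<open>The preimages of \<open>A\<close> and \<open>B\<close> are thickened to closed sets
  \<open>P'\<close> and \<open>Q'\<close> that cover \<open>D\<close>. A map \<open>g\<close> into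
  \<open>A \<inter> B\<close> is chosen first and kept on \<open>P' \<inter> Q'\<close>; then
  \<open>f\<close> and \<open>g\<close> together are extended into \<open>A\<close> for use on
  \<open>P'\<close> and into \<open>B\<close> for use on \<open>Q'\<close>. All extensions are made
  over the whole of \<open>D\<close> and restricted afterwards, so that a single domain
  suffices.\<close>

lemma extensor_Un:
  assumes D: "hereditarily normal_space D" and A: "closedin T A" and B: "closedin T B"
    and EA: "extensor D (subtopology T A)" and EB: "extensor D (subtopology T B)"
    and EAB: "extensor D (subtopology T (A \<inter> B))"
  shows "extensor D (subtopology T (A \<union> B))"
  unfolding extensor_def
proof (intro allI impI, elim conjE)
  fix C f assume C: "closedin D C" and f: "continuous_map (subtopology D C) (subtopology T (A \<union> B)) f"
  have fT: "continuous_map (subtopology D C) T f"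
    using f by (simp add: continuous_map_in_subtopology)
  have CD: "C \<subseteq> topspace D" using C closedin_subset by auto
  have fim: "f x \<in> A \<union> B" if "x \<in> C" for x
    using f that CD by (auto simp: continuous_map_in_subtopology image_subset_iff)
  define P where "P = {x \<in> C. f x \<in> A}"
  define Q where "Q = {x \<in> C. f x \<in> B}"
  have pre: "closedin D {x \<in> C. f x \<in> Z}" if "closedin T Z" for Z
  proof -
    have "closedin (subtopology D C) {x \<in> topspace (subtopology D C). f x \<in> Z}"
      using closedin_continuous_map_preimage[OF fT that] .
    moreover have "{x \<in> topspace (subtopology D C). f x \<in> Z} = {x \<in> C. f x \<in> Z}"
      using CD by auto
    ultimately show ?thesis using closedin_trans_full C by metis
  qed
  have P: "closedin D P" and Q: "closedin D Q" using pre A B by (auto simp: P_def Q_def)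
  have PQ: "P \<union> Q = C" using fim by (auto simp: P_def Q_def)
  have PA: "continuous_map (subtopology D P) (subtopology T A) f"
    and QB: "continuous_map (subtopology D Q) (subtopology T B) f"
    and PQAB: "continuous_map (subtopology D (P \<inter> Q)) (subtopology T (A \<inter> B)) f"
    using continuous_map_from_subtopology_mono[OF fT, of P]
      continuous_map_from_subtopology_mono[OF fT, of Q]
      continuous_map_from_subtopology_mono[OF fT, of "P \<inter> Q"]
    by (auto simp: continuous_map_in_subtopology P_def Q_def)
  obtain P' Q' where P': "closedin D P'" and Q': "closedin D Q'" and cov: "P' \<union> Q' = topspace D"
    and P'C: "P' \<inter> (P \<union> Q) = P" and Q'C: "Q' \<inter> (P \<union> Q) = Q"
    using hereditarily_normal_closed_split[OF D P Q] by blast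
  obtain g where g: "continuous_map D (subtopology T (A \<inter> B)) g"
    and gf: "\<And>x. x \<in> P \<inter> Q \<Longrightarrow> g x = f x"
    using extensorE[OF EAB closedin_Int[OF P Q] PQAB] by blast
  \<comment> \<open>Serves both sides: \<open>f\<close> on \<open>S\<close> and \<open>g\<close> on
    \<open>P' \<inter> Q'\<close> overlap only inside \<open>P \<inter> Q\<close>, where they agree,
    so they glue and extend into \<open>Z\<close>.\<close>
  have ext: "\<exists>k. continuous_map D (subtopology T Z) k \<and> (\<forall>x\<in>P' \<inter> Q'. k x = g x) \<and> (\<forall>x\<in>S. k x = f x)"
    if E: "extensor D (subtopology T Z)" and Z: "A \<inter> B \<subseteq> Z" and S: "closedin D S"
      and fS: "continuous_map (subtopology D S) (subtopology T Z) f"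
      and int: "S \<inter> (P' \<inter> Q') \<subseteq> P \<inter> Q" for Z S
  proof -
    have gZ: "continuous_map (subtopology D (P' \<inter> Q')) (subtopology T Z) g"
      using g Z by (auto simp: continuous_map_in_subtopology image_subset_iff
          intro: continuous_map_from_subtopology)
    obtain h where h: "continuous_map (subtopology D ((P' \<inter> Q') \<union> S)) (subtopology T Z) h"
      and h1: "\<And>x. x \<in> P' \<inter> Q' \<Longrightarrow> h x = g x" and h2: "\<And>x. x \<in> S \<Longrightarrow> h x = f x"
      by (rule continuous_map_glue_closed[OF closedin_Int[OF P' Q'] S gZ fS])
         (use gf int in auto)
    obtain k where "continuous_map D (subtopology T Z) k"
      "\<And>x. x \<in> (P' \<inter> Q') \<union> S \<Longrightarrow> k x = h x"
      using extensorE[OF E closedin_Un[OF closedin_Int[OF P' Q'] S] h] by blast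
    with h1 h2 show ?thesis by (metis UnI1 UnI2)
  qed
  obtain kA where kA: "continuous_map D (subtopology T A) kA" "\<forall>x\<in>P' \<inter> Q'. kA x = g x"
      "\<forall>x\<in>P. kA x = f x"
    using ext[OF EA _ P PA] Q'C by blast
  obtain kB where kB: "continuous_map D (subtopology T B) kB" "\<forall>x\<in>P' \<inter> Q'. kB x = g x"
      "\<forall>x\<in>Q. kB x = f x"
    using ext[OF EB _ Q QB] P'C by blast
  have "continuous_map (subtopology D P') (subtopology T (A \<union> B)) kA"
       "continuous_map (subtopology D Q') (subtopology T (A \<union> B)) kB"
    using kA(1) kB(1) by (auto simp: continuous_map_in_subtopology image_subset_iff
          intro: continuous_map_from_subtopology)
  then obtain h where h: "continuous_map (subtopology D (P' \<union> Q')) (subtopology T (A \<union> B)) h"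
    and hA: "\<And>x. x \<in> P' \<Longrightarrow> h x = kA x" and hB: "\<And>x. x \<in> Q' \<Longrightarrow> h x = kB x"
    by (rule continuous_map_glue_closed[OF P' Q']) (use kA kB in auto)
  have "continuous_map D (subtopology T (A \<union> B)) h" using h cov by simp
  moreover have "h x = f x" if "x \<in> C" for x
  proof -
    have "x \<in> P \<or> x \<in> Q" using that PQ by blast
    then show ?thesis
      using kA(3) kB(3) hA hB P'C Q'C by (metis IntE)
  qed
  ultimately show "\<exists>g. continuous_map D (subtopology T (A \<union> B)) g \<and> (\<forall>x\<in>C. g x = f x)"
    by blast
qed

text \<open>The map is extended over \<open>P\<close> first and then over \<open>Q\<close>, each
  time from the part of the piece on which it is already defined. Thus, for a finite union of closed
  sets, normality is only checked on the pieces.\<close>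

lemma extensor_domain_Un:
  assumes P: "closedin D P" and Q: "closedin D Q"
    and EP: "extensor (subtopology D P) Y" and EQ: "extensor (subtopology D Q) Y"
  shows "extensor (subtopology D (P \<union> Q)) Y"
  unfolding extensor_def
proof (intro allI impI, elim conjE)
  have PQD: "P \<subseteq> topspace D" "Q \<subseteq> topspace D" using P Q closedin_subset by auto
  fix C f assume C: "closedin (subtopology D (P \<union> Q)) C"
    and "continuous_map (subtopology (subtopology D (P \<union> Q)) C) Y f"
  moreover have CPQ: "C \<subseteq> P \<union> Q" using closedin_subset[OF C] by auto
  ultimately have f: "continuous_map (subtopology D C) Y f"
    by (simp add: subtopology_subtopology Int_absorb1)
  have C: "closedin D C" using C P Q closedin_trans_full closedin_Un by metis
  have step: "\<exists>h. continuous_map (subtopology D (B \<union> R)) Y h \<and> (\<forall>x\<in>B. h x = k x)"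
    if B: "closedin D B" and R: "closedin D R" and E: "extensor (subtopology D R) Y"
      and k: "continuous_map (subtopology D B) Y k" for B R k
  proof -
    have "R \<subseteq> topspace D" using R closedin_subset by auto
    have cl: "closedin (subtopology D R) (B \<inter> R)"
      using B by (meson closedin_subtopology)
    have "continuous_map (subtopology (subtopology D R) (B \<inter> R)) Y k"
      using continuous_map_from_subtopology_mono[OF k, of "B \<inter> R"]
      by (simp add: subtopology_subtopology Int_absorb1)
    then obtain g where g: "continuous_map (subtopology D R) Y g" "\<And>x. x \<in> B \<inter> R \<Longrightarrow> g x = k x"
      using extensorE[OF E cl] by metis
    then obtain h where "continuous_map (subtopology D (B \<union> R)) Y h" "\<And>x. x \<in> B \<Longrightarrow> h x = k x"
      using continuous_map_glue_closed[OF B R k g(1)] by (metis IntI)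
    then show ?thesis by blast
  qed
  obtain h where h: "continuous_map (subtopology D (C \<union> P)) Y h" "\<forall>x\<in>C. h x = f x"
    using step[OF C P EP f] by blast
  obtain k where k: "continuous_map (subtopology D (C \<union> P \<union> Q)) Y k" "\<forall>x\<in>C \<union> P. k x = h x"
    using step[OF closedin_Un[OF C P] Q EQ h(1)] by blast
  have "C \<union> P \<union> Q = P \<union> Q" using CPQ by auto
  then show "\<exists>g. continuous_map (subtopology D (P \<union> Q)) Y g \<and> (\<forall>x\<in>C. g x = f x)"
    using h k by auto
qed

lemma extensor_domain_Union:
  assumes "finite I" "I \<noteq> {}" "\<And>i. i \<in> I \<Longrightarrow> closedin D (P i)"
    and "\<And>i. i \<in> I \<Longrightarrow> extensor (subtopology D (P i)) Y"
  shows "extensor (subtopology D (\<Union>i\<in>I. P i)) Y"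
  using assms
proof (induction I rule: finite_ne_induct)
  case (insert i I)
  then show ?case
    using extensor_domain_Un[of D "P i" "\<Union>i\<in>I. P i" Y] by (auto intro: closedin_Union)
qed simp

section \<open>Metrizability and compactness of balls\<close>

lemma metrizable_unit_ball: "metrizable_space (subtopology (Euclidean_space n) (unit_ball n))"
  unfolding Euclidean_space_def
  by (intro metrizable_space_subtopology) (simp add: metrizable_space_product_topology
      metrizable_space_euclidean)

text \<open>\<open>Euclidean_space n\<close> sits in an infinite product of lines. The ball is a
  closed subset of the box with sides \<open>{-1..1}\<close> in the first \<open>n\<close>
  coordinates and \<open>{0}\<close> in all others, which is compact by Tychonoff's theorem.\<close>

lemma compactin_unit_ball: "compactin (Euclidean_space n) (unit_ball n)"
proof -
  let ?Q = "\<Pi>\<^sub>E i\<in>UNIV. if i < n then {-1..1::real} else {0}"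
  have "compactin (powertop_real UNIV) ?Q"
    by (subst compactin_PiE) auto
  moreover have "?Q \<subseteq> topspace (Euclidean_space n)"
  proof
    fix x assume "x \<in> ?Q"
    then have "x i \<in> (if i < n then {-1..1} else {0})" for i by (rule PiE_mem) simp
    then have "x i = 0" if "i \<ge> n" for i using that by (metis leD singletonD)
    then show "x \<in> topspace (Euclidean_space n)" by (simp add: topspace_Euclidean_space)
  qed
  ultimately have Q: "compactin (Euclidean_space n) ?Q"
    by (simp add: Euclidean_space_def compactin_subtopology)
  have "\<bar>x i\<bar> \<le> 1" if "(\<Sum>i<n. (x i)\<^sup>2) \<le> 1" "i < n" for x :: "nat \<Rightarrow> real" and i
  proof -
    have "(x i)\<^sup>2 \<le> (\<Sum>i<n. (x i)\<^sup>2)" using that(2) by (intro member_le_sum) auto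
    with that(1) have "(x i)\<^sup>2 \<le> 1\<^sup>2" by simp
    then show ?thesis by (metis abs_le_square_iff abs_one)
  qed
  then have sub: "unit_ball n \<subseteq> ?Q"
    by (fastforce simp: unit_ball_def topspace_Euclidean_space abs_le_iff PiE_iff)
  have "continuous_map (Euclidean_space n) euclideanreal (\<lambda>x. \<Sum>i<n. (x i)\<^sup>2)"
    unfolding Euclidean_space_def
    by (intro continuous_map_sum continuous_map_real_pow continuous_map_from_subtopology
        continuous_map_product_projection) auto
  then have "closedin (Euclidean_space n) {x \<in> topspace (Euclidean_space n). (\<Sum>i<n. (x i)\<^sup>2) \<in> {..1}}"
    by (rule closedin_continuous_map_preimage) auto
  then have "closedin (Euclidean_space n) (unit_ball n)" by (simp add: unit_ball_def)
  then show ?thesis using closed_compactin[OF Q sub] by simp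
qed

section \<open>Halfspaces and carriers\<close>

text \<open>Only (FS) and (SE) are kept, as these pass to halfspaces and carriers. Simplicity does
  not, since a coordinate is constant on its halfspace.\<close>

definition com :: "'u set \<Rightarrow> ('u \<Rightarrow> int) set \<Rightarrow> bool" where
  "com U K \<longleftrightarrow> K \<subseteq> sign_vectors U \<and>
     (\<forall>X\<in>K. \<forall>Y\<in>K. sv_comp U X (sv_neg U Y) \<in> K) \<and>
     (\<forall>X\<in>K. \<forall>Y\<in>K. \<forall>e\<in>Sep U X Y.
        \<exists>Z\<in>K. Z e = 0 \<and> (\<forall>f\<in>U - Sep U X Y. Z f = sv_comp U X Y f))"

text \<open>If \<open>Y e = 0\<close> and \<open>X\<close> lies below \<open>Y\<close>, then
  \<open>X e = 0\<close>; so this is the union of all faces in \<open>K\<close> that meet the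
  hyperplane of \<open>e\<close>.\<close>

definition carrier :: "'u set \<Rightarrow> ('u \<Rightarrow> int) set \<Rightarrow> 'u \<Rightarrow> ('u \<Rightarrow> int) set" where
  "carrier U K e = {Y \<in> K. \<exists>X\<in>K. X e = 0 \<and> sv_le U X Y}"

lemma com_values: "com U K \<Longrightarrow> X \<in> K \<Longrightarrow> e \<in> U \<Longrightarrow> X e \<in> {-1, 0, 1}"
  unfolding com_def sign_vectors_def by blast

lemma com_FS: "com U K \<Longrightarrow> X \<in> K \<Longrightarrow> Y \<in> K \<Longrightarrow> sv_comp U X (sv_neg U Y) \<in> K"
  unfolding com_def by blast

lemma com_SE:
  assumes "com U K" "X \<in> K" "Y \<in> K" "e \<in> Sep U X Y"
  obtains Z where "Z \<in> K" "Z e = 0" "\<And>f. f \<in> U - Sep U X Y \<Longrightarrow> Z f = sv_comp U X Y f"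
  using assms unfolding com_def by blast

text \<open>Two applications of (FS): in \<open>X \<circ> (-(X \<circ> (-Y)))\<close> the two
  negations cancel where \<open>X\<close> vanishes.\<close>

lemma com_comp:
  assumes "com U K" "X \<in> K" "Y \<in> K"
  shows "sv_comp U X Y \<in> K"
proof -
  have "sv_comp U X (sv_neg U (sv_comp U X (sv_neg U Y))) = sv_comp U X Y"
    by (auto simp: sv_comp_def sv_neg_def)
  then show ?thesis using com_FS[OF assms(1,2) com_FS[OF assms]] by simp
qed

lemma sv_le_refl: "sv_le U X X"
  by (simp add: sv_le_def sign_le_def)

lemma sign_le_trans: "sign_le s t \<Longrightarrow> sign_le t u \<Longrightarrow> sign_le s u"
  by (auto simp: sign_le_def)

lemma sv_le_trans: "sv_le U X Y \<Longrightarrow> sv_le U Y Z \<Longrightarrow> sv_le U X Z"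
  unfolding sv_le_def by (blast intro: sign_le_trans)

lemma sv_le_comp:
  assumes "com U K" "Y \<in> K"
  shows "sv_le U X (sv_comp U X Y)"
  using com_values[OF assms] by (auto simp: sv_le_def sign_le_def sv_comp_def)

text \<open>Composition keeps the nonzero signs of its first factor, and two vectors with the same
  nonzero sign at \<open>e\<close> are not separated there, so elimination keeps that sign too. A
  whole set \<open>E\<close> is treated at once for the sake of the stages below.\<close>

lemma com_halfspaces:
  assumes K: "com U K" and E: "E \<subseteq> U" "\<And>e. e \<in> E \<Longrightarrow> s e \<noteq> 0"
  shows "com U {X \<in> K. \<forall>e\<in>E. X e = s e}"
  unfolding com_def
proof (intro conjI ballI)
  show "{X \<in> K. \<forall>e\<in>E. X e = s e} \<subseteq> sign_vectors U"
    using K by (auto simp: com_def)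
next
  fix X Y assume XY: "X \<in> {X \<in> K. \<forall>e\<in>E. X e = s e}" "Y \<in> {X \<in> K. \<forall>e\<in>E. X e = s e}"
  show "sv_comp U X (sv_neg U Y) \<in> {X \<in> K. \<forall>e\<in>E. X e = s e}"
    using XY E com_FS[OF K] by (auto simp: sv_comp_def)
  fix g assume g: "g \<in> Sep U X Y"
  obtain Z where Z: "Z \<in> K" "Z g = 0" "\<And>f. f \<in> U - Sep U X Y \<Longrightarrow> Z f = sv_comp U X Y f"
    using com_SE[OF K _ _ g] XY by blast
  have "Z e = s e" if e: "e \<in> E" for e
  proof -
    have "X e * Y e \<ge> 0" using XY e by simp
    then have "X e * Y e \<noteq> -1" by linarith
    then show ?thesis using Z(3)[of e] E e XY by (auto simp: Sep_def sv_comp_def)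
  qed
  with Z show "\<exists>Z\<in>{X \<in> K. \<forall>e\<in>E. X e = s e}. Z g = 0 \<and>
      (\<forall>f\<in>U - Sep U X Y. Z f = sv_comp U X Y f)"
    by blast
qed

lemma com_halfspace: "com U K \<Longrightarrow> e \<in> U \<Longrightarrow> s \<noteq> 0 \<Longrightarrow> com U {X \<in> K. X e = s}"
  using com_halfspaces[of U K "{e}" "\<lambda>_. s"] by simp

text \<open>For (FS), \<open>X \<circ> (-Y)\<close> lies above \<open>X\<close>. For (SE),
  eliminating \<open>g\<close> in \<open>K\<close> gives \<open>W\<close>, which may leave the
  carrier. Let \<open>V\<close> vanish at \<open>e\<close> and \<open>g\<close> and have no sign in
  conflict with \<open>X \<circ> Y\<close> off \<open>Sep U X Y\<close>. Then
  \<open>V \<circ> W\<close> lies above \<open>V\<close>, hence in the carrier, and still eliminates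
  \<open>g\<close>. Such a \<open>V\<close> comes from the vectors \<open>X'\<close> and
  \<open>Y'\<close> below \<open>X\<close> and \<open>Y\<close>.\<close>

lemma com_carrier:
  assumes K: "com U K" and e: "e \<in> U"
  shows "com U (carrier U K e)"
  unfolding com_def
proof (intro conjI ballI)
  show "carrier U K e \<subseteq> sign_vectors U"
    using K by (auto simp: com_def carrier_def)
next
  fix X Y assume "X \<in> carrier U K e" "Y \<in> carrier U K e"
  then obtain X' Y' where X: "X \<in> K" and Y: "Y \<in> K" and X': "X' \<in> K" "X' e = 0" "sv_le U X' X"
    and Y': "Y' \<in> K" "Y' e = 0" "sv_le U Y' Y"
    by (auto simp: carrier_def)
  have "sv_le U X (sv_comp U X (sv_neg U Y))"
    using com_values[OF K Y] by (auto simp: sv_le_def sign_le_def sv_comp_def sv_neg_def)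
  then show "sv_comp U X (sv_neg U Y) \<in> carrier U K e"
    using com_FS[OF K X Y] X' sv_le_trans[OF X'(3)] unfolding carrier_def by blast
  fix g assume g: "g \<in> Sep U X Y"
  obtain W where W: "W \<in> K" "W g = 0" "\<And>f. f \<in> U - Sep U X Y \<Longrightarrow> W f = sv_comp U X Y f"
    using com_SE[OF K X Y g] by blast
  have gU: "g \<in> U" using g by (simp add: Sep_def)
  have low: "X' f = 0 \<or> X' f = X f" "Y' f = 0 \<or> Y' f = Y f" if "f \<in> U" for f
    using X'(3) Y'(3) that by (auto simp: sv_le_def sign_le_def)
  \<comment> \<open>Hence off \<open>Sep U X Y\<close> the composition agrees with every nonzero
    sign of \<open>Y\<close> as well as of \<open>X\<close>.\<close>
  have nonsep: "X f = 0 \<or> Y f = 0 \<or> X f = Y f" if "f \<in> U - Sep U X Y" for f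
    using that com_values[OF K X, of f] com_values[OF K Y, of f] by (auto simp: Sep_def)
  have via: "\<exists>Z\<in>carrier U K e. Z g = 0 \<and> (\<forall>f\<in>U - Sep U X Y. Z f = sv_comp U X Y f)"
    if V: "V \<in> K" "V e = 0" "V g = 0"
      and Vf: "\<And>f. f \<in> U - Sep U X Y \<Longrightarrow> V f \<noteq> 0 \<Longrightarrow> V f = sv_comp U X Y f" for V
  proof (intro bexI conjI ballI)
    show "sv_comp U V W g = 0" using V(3) W(2) gU by (simp add: sv_comp_def)
    show "sv_comp U V W f = sv_comp U X Y f" if "f \<in> U - Sep U X Y" for f
    proof (cases "V f = 0")
      case True
      then show ?thesis using W(3)[OF that] that by (simp add: sv_comp_def[of U V W])
    next
      case False
      then show ?thesis using Vf[OF that] that by (simp add: sv_comp_def[of U V W])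
    qed
    show "sv_comp U V W \<in> carrier U K e"
      using com_comp[OF K V(1) W(1)] sv_le_comp[OF K W(1)] V by (auto simp: carrier_def)
  qed
  consider "X' g = 0" | "Y' g = 0" | "X' g = X g" "Y' g = Y g" using low[OF gU] by blast
  then show "\<exists>Z\<in>carrier U K e. Z g = 0 \<and> (\<forall>f\<in>U - Sep U X Y. Z f = sv_comp U X Y f)"
  proof cases
    case 1
    show ?thesis
      by (rule via[OF X'(1,2) 1]) (use low in \<open>fastforce simp: sv_comp_def\<close>)
  next
    case 2
    show ?thesis
    proof (rule via[OF Y'(1,2) 2])
      fix f assume f: "f \<in> U - Sep U X Y" "Y' f \<noteq> 0"
      then have "Y' f = Y f" using low[of f] by auto
      then show "Y' f = sv_comp U X Y f" using f nonsep[OF f(1)] by (auto simp: sv_comp_def)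
    qed
  next
    case 3
    \<comment> \<open>Eliminating \<open>g\<close> between \<open>X'\<close> and \<open>Y'\<close>
      preserves their common zero at \<open>e\<close>.\<close>
    then have "g \<in> Sep U X' Y'" using g by (simp add: Sep_def)
    then obtain V where V: "V \<in> K" "V g = 0"
        "\<And>f. f \<in> U - Sep U X' Y' \<Longrightarrow> V f = sv_comp U X' Y' f"
      using com_SE[OF K X'(1) Y'(1)] by blast
    have "V e = 0" using V(3)[of e] e X'(2) Y'(2) by (simp add: Sep_def sv_comp_def)
    show ?thesis
    proof (rule via[OF V(1) \<open>V e = 0\<close> V(2)])
      fix f assume f: "f \<in> U - Sep U X Y" "V f \<noteq> 0"
      then have fU: "f \<in> U" by simp
      have "f \<notin> Sep U X' Y'"
        using low[OF fU] f(1) by (auto simp: Sep_def)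
      then have "V f = sv_comp U X' Y' f" using V(3) fU by blast
      then show "V f = sv_comp U X Y f"
        using low[OF fU] nonsep[OF f(1)] f(2) fU by (auto simp: sv_comp_def)
    qed
  qed
qed

section \<open>Subcomplexes\<close>

lemma unit_ball_eq: "unit_ball n = open_unit_ball n \<union> unit_sphere n"
  by (auto simp: unit_ball_def open_unit_ball_def unit_sphere_def)

lemma (in regular_cell_complex) compactin_cell:
  assumes "j \<in> J"
  shows "compactin T (\<phi> j ` unit_ball (d j))"
proof (rule image_compactin)
  show "compactin (subtopology (Euclidean_space (d j)) (unit_ball (d j))) (unit_ball (d j))"
    using compactin_unit_ball by (simp add: compactin_subtopology)
  show "continuous_map (subtopology (Euclidean_space (d j)) (unit_ball (d j))) T (\<phi> j)"
    using cell_ball[OF assms] homeomorphic_imp_continuous_map continuous_map_in_subtopology by blast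
qed

lemma (in regular_cell_complex) closedin_cell: "j \<in> J \<Longrightarrow> closedin T (\<phi> j ` unit_ball (d j))"
  using compactin_imp_closedin[OF Hausdorff] compactin_cell by blast

context COM_cell_complex
begin

abbreviation cell where "cell X \<equiv> \<phi> X ` unit_ball (d X)"
abbreviation open_cell where "open_cell X \<equiv> \<phi> X ` open_unit_ball (d X)"

definition cells :: "('u \<Rightarrow> int) set \<Rightarrow> 'p set" where
  "cells K = (\<Union>X\<in>K. cell X)"

text \<open>The order of sign vectors is opposite to inclusion of cells, so passing to faces of a
  cell goes upwards.\<close>

definition up_closed :: "('u \<Rightarrow> int) set \<Rightarrow> bool" where
  "up_closed K \<longleftrightarrow> K \<subseteq> L \<and> (\<forall>X\<in>K. Face U L X \<subseteq> K)"

lemma up_closed_Int: "up_closed A \<Longrightarrow> up_closed B \<Longrightarrow> up_closed (A \<inter> B)"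
  by (auto simp: up_closed_def)

lemma up_closed_Un: "up_closed A \<Longrightarrow> up_closed B \<Longrightarrow> up_closed (A \<union> B)"
  by (auto simp: up_closed_def)

lemma cells_Un: "cells (A \<union> B) = cells A \<union> cells B"
  by (auto simp: cells_def)

lemma up_closed_Face: "X \<in> L \<Longrightarrow> up_closed (Face U L X)"
  unfolding up_closed_def Face_def using sv_le_trans[of U X] by blast

lemma up_closed_halfspace:
  assumes "up_closed K" "e \<in> U" "s \<noteq> 0"
  shows "up_closed {X \<in> K. X e = s}"
  using assms by (auto simp: up_closed_def Face_def sv_le_def sign_le_def)

lemma up_closed_carrier: "up_closed K \<Longrightarrow> up_closed (carrier U K e)"
  unfolding up_closed_def carrier_def Face_def using sv_le_trans[of U] by blast

text \<open>Induction on the dimension: a boundary point lies in a closed cell of smaller dimension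
  contained in \<open>cell X\<close>, and \<open>face_iff\<close> places the index of that cell
  above \<open>X\<close>.\<close>

lemma cell_eq_open_cells: "X \<in> L \<Longrightarrow> cell X = (\<Union>Y\<in>Face U L X. open_cell Y)"
proof (induction "d X" arbitrary: X rule: less_induct)
  case less
  have ge: "open_cell Y \<subseteq> cell X" if "Y \<in> Face U L X" for Y
  proof -
    have "Y \<in> L" using that by (simp add: Face_def)
    then have "cell Y \<subseteq> cell X" using face_iff less.prems that by blast
    then show ?thesis by (auto simp: unit_ball_eq)
  qed
  have le: "\<exists>Y\<in>Face U L X. x \<in> open_cell Y" if x: "x \<in> cell X" for x
  proof (cases "x \<in> open_cell X")
    case True
    then show ?thesis using face_iff[OF less.prems less.prems] by blast
  next
    case False
    obtain K where K: "K \<subseteq> L" "\<forall>k\<in>K. d k < d X" "\<phi> X ` unit_sphere (d X) = (\<Union>k\<in>K. cell k)"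
      using boundary[OF less.prems] by blast
    from False x have "x \<in> \<phi> X ` unit_sphere (d X)" by (auto simp: unit_ball_eq)
    then obtain k where k: "k \<in> K" "x \<in> cell k" using K(3) by blast
    have kL: "k \<in> L" and dk: "d k < d X" using k K by auto
    have "cell k \<subseteq> \<phi> X ` unit_sphere (d X)" using K(3) k by blast
    then have sub: "cell k \<subseteq> cell X" by (auto simp: unit_ball_eq)
    obtain Y where Y: "Y \<in> Face U L k" "x \<in> open_cell Y"
      using less.hyps[OF dk kL] k(2) by blast
    have "k \<in> Face U L X" using face_iff[OF less.prems kL] sub by blast
    with Y have "Y \<in> Face U L X" using sv_le_trans[of U X k Y] by (simp add: Face_def)
    with Y show ?thesis by blast
  qed
  show ?case
  proof (rule equalityI)
    show "cell X \<subseteq> (\<Union>Y\<in>Face U L X. open_cell Y)" using le by (intro subsetI) (simp only: UN_iff)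
    show "(\<Union>Y\<in>Face U L X. open_cell Y) \<subseteq> cell X" using ge by (rule UN_least)
  qed
qed

lemma cells_eq_open_cells:
  assumes "up_closed K"
  shows "cells K = (\<Union>X\<in>K. open_cell X)"
proof -
  have K: "K \<subseteq> L" "\<And>X. X \<in> K \<Longrightarrow> Face U L X \<subseteq> K" using assms by (auto simp: up_closed_def)
  have cell: "cell X = (\<Union>Y\<in>Face U L X. open_cell Y)" if "X \<in> K" for X
    using cell_eq_open_cells that K(1) by blast
  have refl: "X \<in> Face U L X" if "X \<in> K" for X
    using that K(1) by (auto simp: Face_def sv_le_refl)
  show ?thesis
  proof (intro equalityI subsetI)
    fix x assume "x \<in> cells K"
    then obtain X where X: "X \<in> K" "x \<in> cell X" unfolding cells_def by (rule UN_E)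
    from X(2)[unfolded cell[OF X(1)]] obtain Y where Y: "Y \<in> Face U L X" "x \<in> open_cell Y"
      by (rule UN_E)
    then show "x \<in> (\<Union>X\<in>K. open_cell X)" using K(2)[OF X(1)] by (intro UN_I[of Y]) blast
  next
    fix x assume "x \<in> (\<Union>X\<in>K. open_cell X)"
    then obtain X where X: "X \<in> K" "x \<in> open_cell X" by (rule UN_E)
    have "x \<in> cell X" unfolding cell[OF X(1)] by (rule UN_I, rule refl[OF X(1)], rule X(2))
    then show "x \<in> cells K" unfolding cells_def by (rule UN_I[OF X(1)])
  qed
qed

lemma open_cell_unique:
  "X \<in> L \<Longrightarrow> Y \<in> L \<Longrightarrow> x \<in> open_cell X \<Longrightarrow> x \<in> open_cell Y \<Longrightarrow> X = Y"
  using disjoint_family_onD[OF open_cells_disjoint, of X Y] by blast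

text \<open>Closed cells overlap, but written as unions of disjoint open cells the two subcomplexes
  intersect index by index.\<close>

lemma cells_Int:
  assumes A: "up_closed A" and B: "up_closed B"
  shows "cells A \<inter> cells B = cells (A \<inter> B)"
proof -
  have "A \<subseteq> L" "B \<subseteq> L" using A B by (auto simp: up_closed_def)
  then have "(\<Union>X\<in>A. open_cell X) \<inter> (\<Union>X\<in>B. open_cell X) = (\<Union>X\<in>A \<inter> B. open_cell X)"
    using open_cell_unique by blast
  then show ?thesis
    using cells_eq_open_cells A B up_closed_Int[OF A B] by simp
qed

lemma closedin_cells: "K \<subseteq> L \<Longrightarrow> finite K \<Longrightarrow> closedin T (cells K)"
  unfolding cells_def by (intro closedin_Union) (auto intro: closedin_cell)

section \<open>Finite subcomplexes as extensors\<close>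

lemma extensor_cell:
  "normal_space D \<Longrightarrow> X \<in> L \<Longrightarrow> extensor D (subtopology T (cell X))"
  using extensor_homeomorphic_map[OF cell_ball extensor_unit_ball] by blast

lemma extensor_cells_Un:
  assumes "hereditarily normal_space D" "finite A" "finite B" "up_closed A" "up_closed B"
    and "extensor D (subtopology T (cells A))" "extensor D (subtopology T (cells B))"
    and "extensor D (subtopology T (cells (A \<inter> B)))"
  shows "extensor D (subtopology T (cells (A \<union> B)))"
proof -
  have "closedin T (cells A)" "closedin T (cells B)"
    using assms(2-5) closedin_cells by (auto simp: up_closed_def)
  then show ?thesis
    unfolding cells_Un using assms cells_Int[OF assms(4,5)] by (intro extensor_Un) simp_all
qed

text \<open>Each piece must omit an element of \<open>K\<close> for the induction to apply: the
  carrier omits \<open>X\<close>, while the halfspaces and half-carriers omit a vector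
  \<open>Z\<close> with \<open>Z e = 0\<close>. Finite zero sets make the count of zeros strictly
  monotone even when \<open>U\<close> is infinite.\<close>

lemma extensor_cells:
  assumes D: "hereditarily normal_space D"
    and zero: "\<And>X. X \<in> L \<Longrightarrow> finite (zero_set U X)"
    and "finite K" "K \<noteq> {}" "com U K" "up_closed K"
  shows "extensor D (subtopology T (cells K))"
  using assms(3-)
proof (induction "card K" arbitrary: K rule: less_induct)
  case less
  note K = \<open>com U K\<close> and up = \<open>up_closed K\<close> and fin = \<open>finite K\<close>
  have KL: "K \<subseteq> L" using up by (simp add: up_closed_def)
  let ?z = "\<lambda>X. card (zero_set U X)"
  have "Max (?z ` K) \<in> ?z ` K" using fin \<open>K \<noteq> {}\<close> by (intro Max_in) auto
  then obtain X where X: "X \<in> K" "?z X = Max (?z ` K)" by auto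
  then have max: "?z Y \<le> ?z X" if "Y \<in> K" for Y using that fin by simp
  have XL: "X \<in> L" using X KL by blast
  show ?case
  proof (cases "\<forall>Y\<in>K. sv_le U X Y")
    case True
    then have "K \<subseteq> Face U L X" using KL by (auto simp: Face_def)
    then have "cells K = cell X"
      using face_iff[OF XL] X(1) KL unfolding cells_def by blast
    then show ?thesis using extensor_cell[OF hereditarily_inc[OF D] XL] by simp
  next
    case False
    then obtain Y e where Y: "Y \<in> K" and e: "e \<in> U" and nle: "\<not> sign_le (X e) (Y e)"
      by (auto simp: sv_le_def)
    have vals: "X e \<in> {-1,0,1}" "Y e \<in> {-1,0,1}" using com_values[OF K _ e] X Y by auto
    have Xe: "X e \<noteq> 0" using nle vals by (auto simp: sign_le_def)
    \<comment> \<open>Either \<open>Y\<close> itself vanishes at \<open>e\<close>, or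
      \<open>X\<close> and \<open>Y\<close> have opposite signs there and \<open>e\<close> can be
      eliminated.\<close>
    have "\<exists>Z\<in>K. Z e = 0"
    proof (cases "Y e = 0")
      case False
      then have "e \<in> Sep U X Y" using e nle vals by (auto simp: Sep_def sign_le_def)
      then show ?thesis using com_SE[OF K X(1) Y] by metis
    qed (use Y in blast)
    then obtain Z where Z: "Z \<in> K" "Z e = 0" by blast
    define N where "N = carrier U K e"
    define H where "H s = {V \<in> K. V e = s}" for s
    have N: "com U N" "up_closed N" "N \<subseteq> K" "Z \<in> N"
      using com_carrier[OF K e] up_closed_carrier[OF up] Z sv_le_refl
      by (auto simp: N_def carrier_def)
    have XN: "X \<notin> N"
    proof
      assume "X \<in> N"
      then obtain X' where X': "X' \<in> K" "X' e = 0" "sv_le U X' X" by (auto simp: N_def carrier_def)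
      \<comment> \<open>\<open>X'\<close> keeps every zero of \<open>X\<close> and gains
        \<open>e\<close>, against the choice of \<open>X\<close>.\<close>
      have "zero_set U X \<subseteq> zero_set U X'"
        using X'(3) by (auto simp: zero_set_def sv_le_def sign_le_def)
      moreover have "e \<in> zero_set U X' - zero_set U X" using e X'(2) Xe by (simp add: zero_set_def)
      ultimately have "?z X < ?z X'"
        using zero X'(1) KL by (intro psubset_card_mono) auto
      then show False using max[OF X'(1)] by simp
    qed
    have smaller: "extensor D (subtopology T (cells A))"
      if "com U A" "up_closed A" "A \<subseteq> K" "A \<noteq> {}" "V \<in> K" "V \<notin> A" for A V
    proof -
      have "card A < card K" using that(3,5,6) fin by (intro psubset_card_mono) auto
      then show ?thesis using less.hyps[of A] that(1-4) finite_subset[OF _ fin] by simp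
    qed
    have H: "com U (H s)" "up_closed (H s)" "H s \<subseteq> K" "Z \<notin> H s" if "s \<noteq> 0" for s
      using com_halfspace[OF K e that] up_closed_halfspace[OF up e that] Z that by (auto simp: H_def)
    have NH: "com U (N \<inter> H s)" if "s \<noteq> 0" for s
    proof -
      have "N \<inter> H s = {V \<in> N. V e = s}" using N(3) by (auto simp: H_def)
      then show ?thesis using com_halfspace[OF N(1) e that] by simp
    qed
    \<comment> \<open>Above \<open>Z\<close> both signs occur at \<open>e\<close>: one in
      \<open>Z \<circ> X\<close>, the other in \<open>Z \<circ> (-X)\<close>.\<close>
    have ne: "N \<inter> H s \<noteq> {}" if s: "s = X e \<or> s = - X e" for s
    proof -
      have "\<exists>V\<in>K. V e = s \<and> sv_le U Z V"
      proof (cases "s = X e")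
        case True
        then show ?thesis
          using com_comp[OF K Z(1) X(1)] sv_le_comp[OF K X(1)] Z(2) e
          by (intro bexI[of _ "sv_comp U Z X"]) (auto simp: sv_comp_def)
      next
        case False
        have "sv_le U Z (sv_comp U Z (sv_neg U X))"
          using com_values[OF K X(1)] by (auto simp: sv_le_def sign_le_def sv_comp_def sv_neg_def)
        then show ?thesis
          using com_FS[OF K Z(1) X(1)] Z(2) e s False
          by (intro bexI[of _ "sv_comp U Z (sv_neg U X)"]) (auto simp: sv_comp_def sv_neg_def)
      qed
      then show ?thesis using Z by (auto simp: N_def H_def carrier_def)
    qed
    have EN: "extensor D (subtopology T (cells N))"
      by (rule smaller[OF N(1,2,3) _ X(1) XN]) (use N(4) in blast)
    have EH: "extensor D (subtopology T (cells (H s)))"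
      and ENH: "extensor D (subtopology T (cells (N \<inter> H s)))"
      if "s = X e \<or> s = - X e" for s
    proof -
      have s: "s \<noteq> 0" using that Xe by auto
      show "extensor D (subtopology T (cells (H s)))"
        by (rule smaller[OF H(1-3)[OF s] _ Z(1) H(4)[OF s]]) (use ne[OF that] in blast)
      show "extensor D (subtopology T (cells (N \<inter> H s)))"
        by (rule smaller[OF NH[OF s] up_closed_Int[OF N(2) H(2)[OF s]] _ ne[OF that] Z(1)])
           (use H(4)[OF s] N(3) in auto)
    qed
    have fins: "finite N" "finite (H s)" for s
      using fin N(3) finite_subset by (auto simp: H_def)
    have s0: "X e \<noteq> 0" "- X e \<noteq> 0" using Xe by auto
    have E1: "extensor D (subtopology T (cells (N \<union> H (X e))))"
      by (rule extensor_cells_Un[OF D fins N(2) H(2)[OF s0(1)] EN EH ENH]) auto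
    \<comment> \<open>The two halfspaces are disjoint, so the second gluing is again along a
      half-carrier.\<close>
    have int: "(N \<union> H (X e)) \<inter> H (- X e) = N \<inter> H (- X e)"
      using Xe by (auto simp: H_def)
    have "extensor D (subtopology T (cells ((N \<union> H (X e)) \<union> H (- X e))))"
      by (rule extensor_cells_Un[OF D])
         (simp_all add: fins N(2) H(2) s0 up_closed_Un E1 EH ENH int)
    moreover have "(N \<union> H (X e)) \<union> H (- X e) = K"
    proof -
      have "V \<in> N \<union> H (X e) \<union> H (- X e)" if V: "V \<in> K" for V
      proof (cases "V e = 0")
        case True
        then show ?thesis using V sv_le_refl by (auto simp: N_def carrier_def)
      next
        case False
        then have "V e = X e \<or> V e = - X e" using com_values[OF K V e] vals Xe by auto
        then show ?thesis using V by (auto simp: H_def)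
      qed
      then show ?thesis using N(3) by (auto simp: H_def)
    qed
    ultimately show ?thesis by simp
  qed
qed

section \<open>Infinite subcomplexes and open stars\<close>

lemma open_cell_subset_cells: "X \<in> K \<Longrightarrow> open_cell X \<subseteq> cells K"
  unfolding cells_def unit_ball_eq by auto

lemma cells_mono: "A \<subseteq> B \<Longrightarrow> cells A \<subseteq> cells B"
  unfolding cells_def by (rule UN_mono) simp_all

lemma cells_L: "cells L = topspace T"
proof -
  have "up_closed L" by (auto simp: up_closed_def Face_def)
  then show ?thesis using cells_eq_open_cells open_cells_cover by simp
qed

text \<open>By the weak topology it suffices to look inside one cell. There the subcomplex is that
  of \<open>K \<inter> Face U L X\<close>, a finite union of compact cells.\<close>

lemma closedin_cells_up_closed:
  assumes up: "up_closed K" and fin: "\<And>X. X \<in> L \<Longrightarrow> finite (Face U L X)"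
  shows "closedin T (cells K)"
proof (rule weak_topology)
  have KL: "K \<subseteq> L" using up by (simp add: up_closed_def)
  show "cells K \<subseteq> topspace T" using cells_mono[OF KL] cells_L by simp
  fix X assume X: "X \<in> L"
  have XF: "X \<in> Face U L X" using X by (simp add: Face_def sv_le_refl)
  have "cells (Face U L X) = cell X"
    unfolding cells_def
  proof (rule equalityI)
    show "(\<Union>Y\<in>Face U L X. cell Y) \<subseteq> cell X"
      using face_iff[OF X] by (intro UN_least) (simp add: Face_def)
    show "cell X \<subseteq> (\<Union>Y\<in>Face U L X. cell Y)" by (rule UN_upper[OF XF])
  qed
  then have "cells K \<inter> cell X = cells (K \<inter> Face U L X)"
    using cells_Int[OF up up_closed_Face[OF X]] by simp
  moreover have "closedin T (cells (K \<inter> Face U L X))"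
    using closedin_cells[of "K \<inter> Face U L X"] KL fin[OF X] by blast
  ultimately have "closedin T (cells K \<inter> cell X)" by simp
  then show "closedin (subtopology T (cell X)) (cells K \<inter> cell X)"
    by (rule closedin_subset_topspace) (rule Int_lower2)
qed

text \<open>The interior of a subcomplex contains the open star of every cell all of whose cofaces lie
  in the subcomplex.\<close>

lemma open_cell_subset_interior:
  assumes fin: "\<And>X. X \<in> L \<Longrightarrow> finite (Face U L X)"
    and X: "X \<in> L" and low: "{Y \<in> L. sv_le U Y X} \<subseteq> K"
  shows "open_cell X \<subseteq> T interior_of (cells K)"
proof -
  \<comment> \<open>\<open>M\<close> indexes the cells that do not contain \<open>cell X\<close>;
    the complement of their union is the open star of \<open>X\<close>.\<close>
  define M where "M = {Y \<in> L. \<not> sv_le U Y X}"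
  have M: "up_closed M"
    unfolding up_closed_def M_def Face_def using sv_le_trans[of U _ _ X] by blast
  have "open_cell X \<subseteq> topspace T"
    using open_cell_subset_cells[OF X] cells_L by simp
  moreover have "x \<notin> cells M" if x: "x \<in> open_cell X" for x
  proof
    assume "x \<in> cells M"
    then obtain Y where Y: "Y \<in> M" "x \<in> open_cell Y"
      unfolding cells_eq_open_cells[OF M] by (rule UN_E)
    then have "X = Y" using open_cell_unique[OF X _ x] by (simp add: M_def)
    then show False using Y(1) by (simp add: M_def sv_le_refl)
  qed
  ultimately have "open_cell X \<subseteq> topspace T - cells M" by blast
  also have "\<dots> \<subseteq> T interior_of (cells K)"
  proof (rule interior_of_maximal)
    show "openin T (topspace T - cells M)"
      using closedin_cells_up_closed[OF M fin] by blast
    have "L = M \<union> {Y \<in> L. sv_le U Y X}" by (auto simp: M_def)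
    then have "topspace T = cells M \<union> cells {Y \<in> L. sv_le U Y X}"
      using cells_L cells_Un by metis
    then show "topspace T - cells M \<subseteq> cells K" using cells_mono[OF low] by blast
  qed
  finally show ?thesis .
qed

section \<open>Extending homotopies over finite subcomplexes\<close>

abbreviation cylinder :: "(real \<times> 'p) topology" where
  "cylinder \<equiv> prod_topology (top_of_set {0..1}) T"

text \<open>A product of an interval and a ball; this supplies the hereditary normality that
  \<open>extensor_cells\<close> asks of its domain.\<close>

lemma metrizable_cylinder_cell:
  assumes "X \<in> L"
  shows "metrizable_space (subtopology cylinder ({0..1} \<times> cell X))"
proof -
  have "metrizable_space (subtopology T (cell X))"
    using homeomorphic_metrizable_space[OF homeomorphic_map_imp_homeomorphic_space[OF cell_ball[OF assms]]]
      metrizable_unit_ball by simp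
  then have "metrizable_space (prod_topology (top_of_set {0..1::real}) (subtopology T (cell X)))"
    by (simp add: metrizable_space_prod_topology metrizable_space_subtopology metrizable_space_euclidean)
  then show ?thesis by (simp add: prod_topology_subtopology(2))
qed

lemma closedin_cylinder: "closedin T A \<Longrightarrow> closedin cylinder ({0..1} \<times> A)"
  by (simp add: closedin_prod_Times_iff)

text \<open>The identity at time 0, the constant \<open>p\<close> at time 1 and \<open>h\<close> on
  \<open>B\<close> are compatible by \<open>h01\<close> and glue to a map on a closed subset of the
  cylinder over \<open>cells K\<close>. The extensor property of the subcomplex does the
  rest.\<close>

lemma extend_homotopy:
  assumes zero: "\<And>X. X \<in> L \<Longrightarrow> finite (zero_set U X)"
    and K: "finite K" "com U K" "up_closed K" and p: "p \<in> cells K"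
    and B: "closedin cylinder B" "B \<subseteq> {0..1} \<times> cells K"
    and h: "continuous_map (subtopology cylinder B) (subtopology T (cells K)) h"
    and h01: "\<And>x. (0, x) \<in> B \<Longrightarrow> h (0, x) = x" "\<And>x. (1, x) \<in> B \<Longrightarrow> h (1, x) = p"
  obtains g where "continuous_map (subtopology cylinder ({0..1} \<times> cells K)) (subtopology T (cells K)) g"
    "\<And>x. x \<in> cells K \<Longrightarrow> g (0, x) = x" "\<And>x. x \<in> cells K \<Longrightarrow> g (1, x) = p"
    "\<And>z. z \<in> B \<Longrightarrow> g z = h z"
proof -
  have KL: "K \<subseteq> L" using K(3) by (simp add: up_closed_def)
  have Kne: "K \<noteq> {}" using p by (auto simp: cells_def)
  have cK: "closedin T (cells K)" using closedin_cells[OF KL K(1)] .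
  have pT: "p \<in> topspace T" using p closedin_subset[OF cK] by blast
  let ?C = "\<lambda>t::real. {t} \<times> cells K"
  have C: "closedin cylinder (?C t)" if "t \<in> {0..1}" for t
    using that cK by (simp add: closedin_prod_Times_iff closedin_closed_subtopology)
  have "continuous_map (subtopology cylinder (?C 0)) (subtopology T (cells K)) snd"
    by (auto simp: continuous_map_in_subtopology intro: continuous_map_from_subtopology continuous_map_snd)
  moreover have "continuous_map (subtopology cylinder (?C 1)) (subtopology T (cells K)) (\<lambda>_. p)"
    using p pT by simp
  ultimately obtain k where k: "continuous_map (subtopology cylinder (?C 0 \<union> ?C 1)) (subtopology T (cells K)) k"
    and k0: "\<And>z. z \<in> ?C 0 \<Longrightarrow> k z = snd z" and k1: "\<And>z. z \<in> ?C 1 \<Longrightarrow> k z = p"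
    by (rule continuous_map_glue_closed[OF C C, rotated 2]) auto
  obtain f where f: "continuous_map (subtopology cylinder ((?C 0 \<union> ?C 1) \<union> B)) (subtopology T (cells K)) f"
    and fk: "\<And>z. z \<in> ?C 0 \<union> ?C 1 \<Longrightarrow> f z = k z" and fh: "\<And>z. z \<in> B \<Longrightarrow> f z = h z"
    by (rule continuous_map_glue_closed[OF closedin_Un[OF C C] B(1) k h])
       (use k0 k1 h01 in auto)
  let ?D = "subtopology cylinder ({0..1} \<times> cells K)"
  \<comment> \<open>The subcomplex plays two roles: as target it is an extensor, and as base of the
    cylinder it is cut into its cells.\<close>
  have "extensor (subtopology cylinder (\<Union>X\<in>K. {0..1} \<times> cell X)) (subtopology T (cells K))"
  proof (rule extensor_domain_Union[OF K(1) Kne])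
    fix X assume "X \<in> K"
    then have X: "X \<in> L" using KL by blast
    show "closedin cylinder ({0..1} \<times> cell X)" by (rule closedin_cylinder[OF closedin_cell[OF X]])
    show "extensor (subtopology cylinder ({0..1} \<times> cell X)) (subtopology T (cells K))"
      by (rule extensor_cells[OF metrizable_imp_hereditarily_normal_space[OF metrizable_cylinder_cell[OF X]]
            zero K(1) Kne K(2,3)])
  qed
  moreover have "(\<Union>X\<in>K. {0..1::real} \<times> cell X) = {0..1} \<times> cells K"
  proof (rule set_eqI)
    fix z :: "real \<times> 'p"
    show "z \<in> (\<Union>X\<in>K. {0..1} \<times> cell X) \<longleftrightarrow> z \<in> {0..1} \<times> cells K"
      by (cases z) (simp only: cells_def UN_iff mem_Sigma_iff, blast)
  qed
  ultimately have ext: "extensor ?D (subtopology T (cells K))" by simp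
  let ?E = "(?C 0 \<union> ?C 1) \<union> B"
  have EsubD: "?E \<subseteq> {0..1} \<times> cells K" using B(2) by auto
  have E: "closedin ?D ?E"
    using closedin_Un[OF closedin_Un[OF C C] B(1)] EsubD by (simp add: closedin_subset_topspace)
  have "continuous_map (subtopology ?D ?E) (subtopology T (cells K)) f"
    using f EsubD by (simp add: subtopology_subtopology Int_absorb1)
  then obtain g where g: "continuous_map ?D (subtopology T (cells K)) g"
    and gf: "\<And>z. z \<in> ?E \<Longrightarrow> g z = f z"
    using extensorE[OF ext E] by blast
  show thesis
  proof
    show "continuous_map ?D (subtopology T (cells K)) g" by (rule g)
    show "g (0, x) = x" "g (1, x) = p" if "x \<in> cells K" for x
      using that gf fk k0 k1 by auto
    show "g z = h z" if "z \<in> B" for z using that gf fh by auto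
  qed
qed

end

section \<open>Exhaustion by finite stages and the contraction\<close>

locale finitary_COM_complex = finitary_COM U L + COM_cell_complex U L T d \<phi>
  for U :: "'u set" and L :: "('u \<Rightarrow> int) set" and T :: "'p topology"
    and d :: "('u \<Rightarrow> int) \<Rightarrow> nat" and \<phi> :: "('u \<Rightarrow> int) \<Rightarrow> (nat \<Rightarrow> real) \<Rightarrow> 'p"
begin

lemma com_L: "com U L"
  unfolding com_def using sign_vectors FS SE by blast

lemma finite_zero_set: "X \<in> L \<Longrightarrow> finite (zero_set U X)"
  using PZ by blast

text \<open>Elements of \<open>L\<close> are extensional on \<open>U\<close>, so such a
  \<open>Y\<close> is determined by its signs on the finite set \<open>U \<inter> E\<close>.
  \<open>Z\<close> need not be a sign vector.\<close>

lemma finite_agree_outside: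
  assumes "finite E"
  shows "finite {Y \<in> L. \<forall>e\<in>U - E. Y e = Z e}" (is "finite ?A")
proof (rule finite_imageD)
  have "(\<lambda>Y. restrict Y (U \<inter> E)) ` ?A \<subseteq> (U \<inter> E) \<rightarrow>\<^sub>E {-1, 0, 1}"
    by (intro image_subsetI restrict_PiE_iff[THEN iffD2] ballI) (use com_values[OF com_L] in blast)
  moreover have "finite ((U \<inter> E) \<rightarrow>\<^sub>E {-1, 0, 1::int})"
    using assms by (intro finite_PiE) auto
  ultimately show "finite ((\<lambda>Y. restrict Y (U \<inter> E)) ` ?A)" by (rule finite_subset)
  show "inj_on (\<lambda>Y. restrict Y (U \<inter> E)) ?A"
  proof (rule inj_onI)
    fix X Y assume X: "X \<in> ?A" and Y: "Y \<in> ?A" and eq: "restrict X (U \<inter> E) = restrict Y (U \<inter> E)"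
    have ext: "X \<in> extensional U" "Y \<in> extensional U"
      using X Y sign_vectors by (auto simp: sign_vectors_def PiE_def)
    show "X = Y"
    proof (rule extensionalityI[OF ext])
      fix e assume "e \<in> U"
      then show "X e = Y e"
        using X Y fun_cong[OF eq, of e] by (cases "e \<in> E") auto
    qed
  qed
qed

lemma finite_Face:
  assumes "X \<in> L"
  shows "finite (Face U L X)"
proof (rule finite_subset[OF _ finite_agree_outside[OF finite_zero_set[OF assms], of X]])
  show "Face U L X \<subseteq> {Y \<in> L. \<forall>e\<in>U - zero_set U X. Y e = X e}"
    by (auto simp: Face_def sv_le_def sign_le_def zero_set_def)
qed

text \<open>By (PZ) all but finitely many signs of a vector are negative, so every vector enters
  some stage. Each stage is an intersection of negative halfspaces; early ones may be empty.\<close>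

definition stage :: "nat \<Rightarrow> ('u \<Rightarrow> int) set" where
  "stage n = {X \<in> L. \<forall>e\<in>{e \<in> U. n \<le> to_nat_on U e}. X e = -1}"

lemma com_stage: "com U (stage n)"
  unfolding stage_def by (rule com_halfspaces[OF com_L]) auto

lemma up_closed_stage: "up_closed (stage n)"
  by (auto simp: up_closed_def stage_def Face_def sv_le_def sign_le_def)

lemma stage_mono: "m \<le> n \<Longrightarrow> stage m \<subseteq> stage n"
  by (auto simp: stage_def)

lemma finite_stage: "finite (stage n)"
proof (rule finite_subset[OF _ finite_agree_outside])
  have "inj_on (to_nat_on U) {e \<in> U. to_nat_on U e < n}"
    using inj_on_to_nat_on[OF countable_ground] by (rule inj_on_subset) auto
  moreover have "finite (to_nat_on U ` {e \<in> U. to_nat_on U e < n})"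
    by (rule finite_subset[of _ "{..<n}"]) auto
  ultimately show "finite {e \<in> U. to_nat_on U e < n}" by (rule finite_imageD[rotated])
  show "stage n \<subseteq> {Y \<in> L. \<forall>e\<in>U - {e \<in> U. to_nat_on U e < n}. Y e = (\<lambda>_. -1) e}"
    by (auto simp: stage_def)
qed

lemma ex_stage:
  assumes X: "X \<in> L"
  shows "\<exists>n. X \<in> stage n"
proof -
  have "finite (pos_set U X \<union> zero_set U X)" using PZ[OF X] by blast
  then have "finite (to_nat_on U ` (pos_set U X \<union> zero_set U X))" by simp
  then obtain n where n: "\<forall>k\<in>to_nat_on U ` (pos_set U X \<union> zero_set U X). k < n"
    using finite_nat_set_iff_bounded by blast
  have "X e = -1" if "e \<in> U" "n \<le> to_nat_on U e" for e
  proof -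
    have "e \<notin> pos_set U X \<union> zero_set U X" using n that(2) by (metis imageI leD)
    then show ?thesis using com_values[OF com_L X that(1)] that(1) by (auto simp: pos_set_def zero_set_def)
  qed
  then show ?thesis using X by (auto simp: stage_def)
qed

lemma finite_subset_stage:
  assumes "finite A" "A \<subseteq> L"
  shows "\<exists>n. A \<subseteq> stage n"
  using assms
proof (induction A rule: finite_induct)
  case (insert X A)
  then obtain m where "A \<subseteq> stage m" by blast
  moreover obtain n where "X \<in> stage n" using ex_stage insert.prems by blast
  ultimately have "insert X A \<subseteq> stage (max m n)"
    using stage_mono[of m "max m n"] stage_mono[of n "max m n"] by auto
  then show ?case by blast
qed simp

text \<open>An open cell lies in the interior of any stage that contains all vectors below its
  index. By (I) these are finitely many, and the stages are nested, so one stage contains them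
  all.\<close>

lemma interior_stages_cover:
  assumes "x \<in> topspace T"
  shows "\<exists>n. x \<in> T interior_of (cells (stage n))"
proof -
  have "x \<in> (\<Union>X\<in>L. open_cell X)" using assms by (simp only: open_cells_cover)
  then obtain X where X: "X \<in> L" "x \<in> open_cell X" by (rule UN_E)
  have "finite {Y \<in> L. sv_le U Y X}" by (rule I[OF X(1)])
  then obtain n where "{Y \<in> L. sv_le U Y X} \<subseteq> stage n"
    using finite_subset_stage[of "{Y \<in> L. sv_le U Y X}"] by blast
  from subsetD[OF open_cell_subset_interior[OF finite_Face X(1) this] X(2)] show ?thesis by blast
qed

text \<open>Contractions of the stages are chosen recursively, each extending the one before, and
  pasted along the open sets \<open>W n\<close>. Since these are open in the cylinder, continuity
  follows without comparing the product topology with a weak topology on the cylinder.\<close>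

lemma contractible: "contractible_space T"
\<comment> \<open>\<open>L\<close> can be empty when \<open>U\<close> is;
  \<open>contractible_space\<close> admits the empty space.\<close>
proof (cases "topspace T = {}")
  case True
  then show ?thesis by (simp add: null_topspace_iff_trivial)
next
  case False
  then obtain p where "p \<in> topspace T" by blast
  then obtain N where "p \<in> T interior_of (cells (stage N))" using interior_stages_cover[of p] by blast
  then have pN: "p \<in> cells (stage N)" by (rule subsetD[OF interior_of_subset])
  \<comment> \<open>The shift by \<open>N\<close> puts \<open>p\<close> into every
    \<open>A n\<close>.\<close>
  define A where "A n = cells (stage (N + n))" for n
  have A_mono: "A m \<subseteq> A n" if "m \<le> n" for m n
    unfolding A_def by (intro cells_mono stage_mono) (use that in simp)
  have pA: "p \<in> A n" for n using A_mono[of 0 n] pN by (auto simp: A_def)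
  have clA: "closedin T (A n)" for n
    unfolding A_def using closedin_cells finite_stage up_closed_stage by (simp add: up_closed_def)
  \<comment> \<open>The contraction stays inside \<open>A n\<close>, as the extensor property
    concerns maps into a single stage.\<close>
  define good where "good n h \<longleftrightarrow>
      continuous_map (subtopology cylinder ({0..1} \<times> A n)) (subtopology T (A n)) h \<and>
      (\<forall>x\<in>A n. h (0, x) = x \<and> h (1, x) = p)" for n and h :: "real \<times> 'p \<Rightarrow> 'p"
  have extend: "\<exists>g. good n g \<and> (\<forall>z\<in>B. g z = h z)"
    if "closedin cylinder B" "B \<subseteq> {0..1} \<times> A n"
      and "continuous_map (subtopology cylinder B) (subtopology T (A n)) h"
      and "\<And>x. (0, x) \<in> B \<Longrightarrow> h (0, x) = x" "\<And>x. (1, x) \<in> B \<Longrightarrow> h (1, x) = p" for n B h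
  proof (rule extend_homotopy[OF finite_zero_set finite_stage com_stage up_closed_stage
        pA[of n, unfolded A_def] that[unfolded A_def]])
    fix g assume "continuous_map (subtopology cylinder ({0..1} \<times> cells (stage (N + n))))
        (subtopology T (cells (stage (N + n)))) g"
      "\<And>x. x \<in> cells (stage (N + n)) \<Longrightarrow> g (0, x) = x"
      "\<And>x. x \<in> cells (stage (N + n)) \<Longrightarrow> g (1, x) = p" "\<And>z. z \<in> B \<Longrightarrow> g z = h z"
    then show ?thesis by (intro exI[of _ g] conjI ballI) (simp_all add: good_def A_def)
  qed
  have "\<exists>h. \<forall>n. good n (h n) \<and> (\<forall>z\<in>{0..1} \<times> A n. h (Suc n) z = h n z)"
  proof (rule dependent_nat_choice)
    \<comment> \<open>Nothing is prescribed besides the two ends; the constant map is a dummy on the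
      empty set.\<close>
    show "\<exists>g. good 0 g" using extend[of "{}" 0 "\<lambda>_. p"] by auto
    fix h n assume h: "good n h"
    have sub: "A n \<subseteq> A (Suc n)" using A_mono by simp
    show "\<exists>g. good (Suc n) g \<and> (\<forall>z\<in>{0..1} \<times> A n. g z = h z)"
    proof (rule extend)
      show "closedin cylinder ({0..1} \<times> A n)" by (rule closedin_cylinder[OF clA])
      show "{0..1} \<times> A n \<subseteq> {0..1} \<times> A (Suc n)" using sub by auto
      show "continuous_map (subtopology cylinder ({0..1} \<times> A n)) (subtopology T (A (Suc n))) h"
        using h sub by (auto simp: good_def continuous_map_in_subtopology image_subset_iff)
    qed (use h in \<open>auto simp: good_def\<close>)
  qed
  then obtain h where good: "\<And>n. good n (h n)"
    and hSuc: "\<And>n z. z \<in> {0..1} \<times> A n \<Longrightarrow> h (Suc n) z = h n z"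
    by blast
  have agree: "h n z = h m z" if "m \<le> n" "z \<in> {0..1} \<times> A m" for m n z
    using that(1)
  proof (induction n rule: dec_induct)
    case (step n)
    have "z \<in> {0..1} \<times> A n" using that(2) A_mono[OF step.hyps(1)] by auto
    then show ?case using hSuc step.IH by simp
  qed simp
  define W where "W n = {0..1::real} \<times> (T interior_of A n)" for n
  have WA: "W n \<subseteq> {0..1} \<times> A n" for n
    unfolding W_def by (rule Sigma_mono[OF order_refl interior_of_subset])
  have cover: "\<exists>n. x \<in> T interior_of A n" if x: "x \<in> topspace T" for x
  proof -
    obtain n where n: "x \<in> T interior_of (cells (stage n))" using interior_stages_cover[OF x] by blast
    have "cells (stage n) \<subseteq> A n" unfolding A_def by (intro cells_mono stage_mono) simp
    from subsetD[OF interior_of_mono[OF this] n] show ?thesis by blast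
  qed
  obtain H where H: "continuous_map cylinder T H"
    and Hh: "\<And>z n. z \<in> topspace cylinder \<inter> W n \<Longrightarrow> H z = h n z"
  proof (rule pasting_lemma_exists[where X=cylinder and I=UNIV and T=W and Y=T and f=h])
    from cover show "topspace cylinder \<subseteq> (\<Union>n\<in>UNIV. W n)" by (auto simp: W_def)
    show "openin cylinder (W n)" for n
      unfolding W_def by (simp add: openin_prod_Times_iff)
    show "continuous_map (subtopology cylinder (W n)) T (h n)" for n
      using good[of n] WA[of n] unfolding good_def continuous_map_in_subtopology
      by (blast intro: continuous_map_from_subtopology_mono)
    show "h m z = h n z" if "z \<in> topspace cylinder \<inter> W m \<inter> W n" for m n z
    proof -
      have "z \<in> {0..1} \<times> A m" "z \<in> {0..1} \<times> A n" using that WA by blast+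
      then show ?thesis using agree[of m n z] agree[of n m z] by (metis nat_le_linear)
    qed
  qed auto
  have ends: "H (0, x) = x" "H (1, x) = p" if x: "x \<in> topspace T" for x
  proof -
    obtain n where xn: "x \<in> T interior_of A n" using cover[OF x] by blast
    then have "x \<in> A n" by (rule subsetD[OF interior_of_subset])
    moreover have "H (0, x) = h n (0, x)" "H (1, x) = h n (1, x)"
      using Hh[of _ n] x xn by (auto simp: W_def)
    ultimately show "H (0, x) = x" "H (1, x) = p" using good[of n] by (auto simp: good_def)
  qed
  have "homotopic_with (\<lambda>_. True) T T id (\<lambda>_. p)"
    by (subst homotopic_with) (use H ends in auto)
  then show ?thesis unfolding contractible_space_def by blast
qed

end

theorem theorem15:
  fixes U :: "'u set" and L :: "('u \<Rightarrow> int) set" and T :: "'p topology"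
    and d :: "('u \<Rightarrow> int) \<Rightarrow> nat" and \<phi> :: "('u \<Rightarrow> int) \<Rightarrow> (nat \<Rightarrow> real) \<Rightarrow> 'p"
  assumes "finitary_COM U L"
    and "COM_cell_complex U L T d \<phi>"
  shows "contractible_space T"
proof -
  interpret finitary_COM U L by fact
  interpret COM_cell_complex U L T d \<phi> by fact
  interpret finitary_COM_complex U L T d \<phi> ..
  show ?thesis by (rule contractible)
qed

end
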